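(* Let $D\geq 2$ be an integer. Every $\left(\frac{6D+5}{3(D+1)},\frac{2}{3(D+1)}\right)$-sparse simple graph $G$ has a $(D,\mathrm{F})$-coloring, i.e. a partition $(M,F)$ of $V(G)$ such that $G[M]$ is a forest with maximum degree at most $D$ and $G[F]$ is a forest.
   Context: For $a>0$ and real $b$, a graph $H$ is $(a,b)$-sparse if it is loopless and for every $A\subseteq V(H)$ with $|A|\geq 2$, the induced subgraph $H[A]$ has at most $a|A|+b$ edges. *)

theory Defs
  imports Complex_Main
begin

type_synonym 'a graph = "'a set \<times> 'a set set"

abbreviation verts :: "'a graph \<Rightarrow> 'a set" where
  "verts G \<equiv> fst G"

abbreviation edges :: "'a graph \<Rightarrow> 'a set set" where
  "edges G \<equiv> snd G"

definition simple_graph :: "'a graph \<Rightarrow> bool" where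
  "simple_graph G \<longleftrightarrow> finite (verts G) \<and> (\<forall>e\<in>edges G. e \<subseteq> verts G \<and> card e = 2)"

definition induced :: "'a graph \<Rightarrow> 'a set \<Rightarrow> 'a graph" where
  "induced G A = (A, {e \<in> edges G. e \<subseteq> A})"

text \<open>An edge that is a singleton is a loop. Looplessness is part of sparsity because the
  bound below says nothing about sets \<open>A\<close> with fewer than two vertices.\<close>

definition loopless :: "'a graph \<Rightarrow> bool" where
  "loopless G \<longleftrightarrow> (\<forall>e\<in>edges G. card e \<noteq> 1)"

definition sparse :: "real \<Rightarrow> real \<Rightarrow> 'a graph \<Rightarrow> bool" where
  "sparse a b G \<longleftrightarrow> loopless G \<and>
     (\<forall>A\<subseteq>verts G. card A \<ge> 2 \<longrightarrow>
        real (card (edges (induced G A))) \<le> a * real (card A) + b)"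

text \<open>A cycle is given by the list of its vertices in cyclic order; the first vertex is not
  repeated at the end.\<close>

definition cycle :: "'a graph \<Rightarrow> 'a list \<Rightarrow> bool" where
  "cycle G c \<longleftrightarrow> length c \<ge> 3 \<and> distinct c \<and> set c \<subseteq> verts G \<and>
     (\<forall>i<length c. {c ! i, c ! (Suc i mod length c)} \<in> edges G)"

definition forest :: "'a graph \<Rightarrow> bool" where
  "forest G \<longleftrightarrow> (\<nexists>c. cycle G c)"

definition degree :: "'a graph \<Rightarrow> 'a \<Rightarrow> nat" where
  "degree G v = card {e \<in> edges G. v \<in> e}"

text \<open>The maximum degree condition is stated vertex by vertex, so it also makes sense for
  the graph without vertices: either part of the partition may be empty.\<close>

definition DF_coloring :: "nat \<Rightarrow> 'a graph \<Rightarrow> 'a set \<Rightarrow> 'a set \<Rightarrow> bool" where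
  "DF_coloring D G M F \<longleftrightarrow> M \<union> F = verts G \<and> M \<inter> F = {} \<and>
     forest (induced G M) \<and> (\<forall>v\<in>M. degree (induced G M) v \<le> D) \<and>
     forest (induced G F)"

end

theory Submission
  imports Defs
begin

text \<open>
  The statement is proved for graphs whose vertices carry a weight \<open>k v \<le> D + 1\<close> that reduces
  their capacity in \<open>M\<close>, under the hypothesis that every vertex set has potential at least \<open>-2\<close>.
  Let \<open>V\<close> be the vertex set of a minimal counterexample. If some proper subset with at least two
  vertices had potential at most \<open>3 * D\<close>, take one, \<open>A\<close>, of least potential. Then each outside
  vertex has at most one neighbour in \<open>A\<close>, and a coloring of \<open>A\<close> extends to \<open>V\<close> by applying
  minimality to \<open>V - A\<close>, together with one vertex representing \<open>A\<close>. Hence all such sets have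
  potential at least \<open>3 * D + 1\<close>. It follows that all degrees are at least two, that vertices of
  degree two have \<open>k v = D + 1\<close>, and that vertices of degree three have \<open>k v \<ge> D\<close>. Splitting each
  edge between its ends, every vertex then contributes at most \<open>-1\<close> to the potential of \<open>V\<close>,
  which is therefore at most \<open>-3\<close>.
\<close>

section \<open>Edge counts, colorings with capacities, and potential\<close>

definition ecount :: "'a set set \<Rightarrow> 'a set \<Rightarrow> nat" where
  "ecount E B = card {e \<in> E. e \<subseteq> B}"

definition nbrs :: "'a set set \<Rightarrow> 'a \<Rightarrow> 'a set \<Rightarrow> nat" where
  "nbrs E u B = card {v \<in> B. {u, v} \<in> E}"

text \<open>Acyclicity in the form of an edge count, which adds up when vertex sets are glued.\<close>

definition acyc :: "'a set set \<Rightarrow> 'a set \<Rightarrow> bool" where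
  "acyc E S \<longleftrightarrow> (\<forall>B\<subseteq>S. B \<noteq> {} \<longrightarrow> ecount E B < card B)"

text \<open>The weight \<open>k v\<close> counts neighbours of \<open>v\<close> in \<open>M\<close> that are fixed outside the graph;
  \<open>k v = D + 1\<close> forces \<open>v\<close> into \<open>F\<close>.\<close>

definition col :: "nat \<Rightarrow> 'a set set \<Rightarrow> ('a \<Rightarrow> nat) \<Rightarrow> 'a set \<Rightarrow> 'a set \<Rightarrow> 'a set \<Rightarrow> bool" where
  "col D E k V M F \<longleftrightarrow> M \<union> F = V \<and> M \<inter> F = {} \<and> acyc E M \<and> acyc E F \<and>
     (\<forall>v\<in>M. nbrs E v M + k v \<le> D)"

text \<open>The price \<open>3\<close> of a unit of \<open>k\<close> is the cost of attaching a \<open>K\<^sub>4\<close> at \<open>v\<close>: its three new vertices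
  and six edges contribute \<open>3 * (6 * D + 5) - 18 * (D + 1) = -3\<close>, and one of the new vertices lies
  in \<open>M\<close> whenever \<open>v\<close> does. Forcing a vertex into \<open>F\<close> thus costs at most as much as one edge.\<close>

definition pot :: "nat \<Rightarrow> 'a set set \<Rightarrow> ('a \<Rightarrow> nat) \<Rightarrow> 'a set \<Rightarrow> int" where
  "pot D E k A = (\<Sum>v\<in>A. 6 * int D + 5 - 3 * int (k v)) - 3 * (int D + 1) * int (ecount E A)"

lemma ecount_empty:
  assumes "\<forall>e\<in>E. card e = 2"
  shows "ecount E {} = 0"
  using assms by (auto simp: ecount_def)

lemma nbrs_empty [simp]: "nbrs E u {} = 0"
  by (simp add: nbrs_def)

lemma ecount_insert:
  assumes E: "\<forall>e\<in>E. card e = 2" and "finite B" "u \<notin> B"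
  shows "ecount E (insert u B) = ecount E B + nbrs E u B"
proof -
  let ?N = "(\<lambda>v. {u, v}) ` {v \<in> B. {u, v} \<in> E}"
  have split: "{e \<in> E. e \<subseteq> insert u B} = {e \<in> E. e \<subseteq> B} \<union> ?N"
  proof (intro equalityI subsetI)
    fix e assume e: "e \<in> {e \<in> E. e \<subseteq> insert u B}"
    show "e \<in> {e \<in> E. e \<subseteq> B} \<union> ?N"
    proof (cases "u \<in> e")
      case True
      then obtain v where v: "e = {u, v}" "v \<noteq> u"
        using E e by (fastforce simp: card_2_iff)
      then show ?thesis using e by auto
    qed (use e in auto)
  qed auto
  have "inj_on (\<lambda>v. {u, v}) {v \<in> B. {u, v} \<in> E}"
    using assms(3) by (auto simp: inj_on_def doubleton_eq_iff)
  then have "card ?N = nbrs E u B" by (simp add: nbrs_def card_image)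
  moreover have "{e \<in> E. e \<subseteq> B} \<inter> ?N = {}" using assms(3) by auto
  moreover have "finite {e \<in> E. e \<subseteq> B}" using assms(2) by simp
  ultimately show ?thesis
    unfolding ecount_def split using assms(2) by (subst card_Un_disjoint) auto
qed

lemma nbrs_Un:
  assumes "finite A" "finite B" "A \<inter> B = {}"
  shows "nbrs E u (A \<union> B) = nbrs E u A + nbrs E u B"
proof -
  have "{v \<in> A \<union> B. {u, v} \<in> E} = {v \<in> A. {u, v} \<in> E} \<union> {v \<in> B. {u, v} \<in> E}" by auto
  then show ?thesis unfolding nbrs_def using assms by (simp add: card_Un_disjoint disjoint_iff)
qed

lemma nbrs_mono: "finite B \<Longrightarrow> A \<subseteq> B \<Longrightarrow> nbrs E u A \<le> nbrs E u B"
  unfolding nbrs_def by (rule card_mono) auto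

lemma nbrs_insert:
  assumes "finite A" "v \<notin> A"
  shows "nbrs E u (insert v A) = nbrs E u A + (if {u, v} \<in> E then 1 else 0)"
proof -
  have "{w \<in> {v}. {u, w} \<in> E} = (if {u, v} \<in> E then {v} else {})" by auto
  then show ?thesis using nbrs_Un[of A "{v}" E u] assms by (simp add: nbrs_def)
qed

lemma nbrs_self:
  assumes "\<forall>e\<in>E. card e = 2" "finite A"
  shows "nbrs E v (insert v A) = nbrs E v A"
proof -
  have "{v} \<notin> E" using assms by auto
  then have "{w \<in> insert v A. {v, w} \<in> E} = {w \<in> A. {v, w} \<in> E}" by auto
  then show ?thesis by (simp add: nbrs_def)
qed

lemma nbrs_eq_0_iff: "finite A \<Longrightarrow> nbrs E u A = 0 \<longleftrightarrow> (\<forall>v\<in>A. {u, v} \<notin> E)"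
  unfolding nbrs_def by auto

lemma ecount_Un:
  assumes E: "\<forall>e\<in>E. card e = 2" and A: "finite A" and "finite X" "A \<inter> X = {}"
  shows "ecount E (A \<union> X) = ecount E A + ecount E X + (\<Sum>u\<in>X. nbrs E u A)"
  using assms(3,4)
proof (induction X rule: finite_induct)
  case empty
  then show ?case using ecount_empty[OF E] by simp
next
  case (insert u X)
  have "ecount E (A \<union> insert u X) = ecount E (insert u (A \<union> X))" by simp
  also have "\<dots> = ecount E (A \<union> X) + nbrs E u (A \<union> X)"
    using insert A by (subst ecount_insert[OF E]) auto
  finally show ?case
    using insert A ecount_insert[OF E, of X u] nbrs_Un[of A X E u] by auto
qed

lemma sum_nbrs_single:
  assumes "finite A"
  shows "(\<Sum>v\<in>A. if {v, u} \<in> E then 1 else 0) = nbrs E u A"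
  using assms by (simp add: nbrs_def sum.If_cases insert_commute Int_def)

lemma handshake:
  assumes E: "\<forall>e\<in>E. card e = 2" and "finite A"
  shows "(\<Sum>v\<in>A. nbrs E v A) = 2 * ecount E A"
  using assms(2)
proof (induction A rule: finite_induct)
  case empty
  then show ?case using ecount_empty[OF E] by simp
next
  case (insert u A)
  have "(\<Sum>v\<in>A. nbrs E v (insert u A)) = (\<Sum>v\<in>A. nbrs E v A) + nbrs E u A"
    using insert(1,2) sum_nbrs_single[of A u E] by (simp add: nbrs_insert sum.distrib)
  then show ?case using insert ecount_insert[OF E, of A u] nbrs_self[OF E, of A u] by simp
qed

lemma pot_Un:
  assumes "\<forall>e\<in>E. card e = 2" "finite A" "finite X" "A \<inter> X = {}"
  shows "pot D E k (A \<union> X) = pot D E k A + pot D E k X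
     - 3 * (int D + 1) * int (\<Sum>u\<in>X. nbrs E u A)"
  unfolding pot_def ecount_Un[OF assms] sum.union_disjoint[OF assms(2-4)]
  by (simp add: algebra_simps)

lemma pot_insert:
  assumes "\<forall>e\<in>E. card e = 2" "finite A" "u \<notin> A"
  shows "pot D E k (insert u A) = pot D E k A + 6 * int D + 5 - 3 * int (k u)
     - 3 * (int D + 1) * int (nbrs E u A)"
  unfolding pot_def ecount_insert[OF assms] using assms(2,3)
  by (simp add: algebra_simps)

text \<open>Sparsity and the potential gap concern only sets with at least two vertices. A single
  vertex contributes at least 6D+5-3(D+1) = 3D+2.\<close>

lemma pot_small:
  assumes E: "\<forall>e\<in>E. card e = 2" and "finite A" "card A \<le> 1" "\<forall>v\<in>A. k v \<le> D + 1"
  shows "pot D E k A \<ge> -2"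
proof -
  have e: "pot D E k {} = 0" by (simp add: pot_def ecount_empty[OF E])
  from assms consider "A = {}" | v where "A = {v}"
    by (metis card_0_eq card_1_singletonE le_SucE le_zero_eq One_nat_def)
  then show ?thesis
  proof cases
    case (2 v)
    then show ?thesis using pot_insert[OF E, of "{}" v D k] e assms(4) by simp
  qed (use e in simp)
qed

section \<open>Acyclic sets and their unions\<close>

lemma acyc_mono: "acyc E S \<Longrightarrow> T \<subseteq> S \<Longrightarrow> acyc E T"
  unfolding acyc_def by blast

lemma acyc_empty [simp]: "acyc E {}"
  by (auto simp: acyc_def)

text \<open>The premise \<open>join\<close> is the edge count for \<open>T\<close> with
  \<open>S\<close> contracted to one extra vertex, so \<open>card B\<close> stands for
  \<open>card B + 1\<close> minus one. A set meeting both parts owes its strict inequality to the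
  part in \<open>S\<close>.\<close>

lemma acyc_Un:
  assumes E: "\<forall>e\<in>E. card e = 2" and fin: "finite S" "finite T" and "S \<inter> T = {}"
    and "acyc E S" "acyc E T"
    and join: "\<And>B. B \<subseteq> T \<Longrightarrow> ecount E B + (\<Sum>u\<in>B. nbrs E u S) \<le> card B"
  shows "acyc E (S \<union> T)"
  unfolding acyc_def
proof (intro allI impI)
  fix B assume B: "B \<subseteq> S \<union> T" "B \<noteq> {}"
  show "ecount E B < card B"
  proof (cases "B \<inter> S = {}")
    case True
    then have "B \<subseteq> T" using B(1) by blast
    then show ?thesis using B(2) assms(6) unfolding acyc_def by blast
  next
    case False
    let ?S = "B \<inter> S" and ?T = "B \<inter> T"
    have un: "B = ?S \<union> ?T" and disj: "?S \<inter> ?T = {}" using B assms(4) by auto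
    have f: "finite ?S" "finite ?T" using fin by auto
    have "ecount E B = ecount E ?S + ecount E ?T + (\<Sum>u\<in>?T. nbrs E u ?S)"
      using ecount_Un[OF E f disj] un by simp
    also have "(\<Sum>u\<in>?T. nbrs E u ?S) \<le> (\<Sum>u\<in>?T. nbrs E u S)"
      by (intro sum_mono nbrs_mono fin) auto
    finally have "ecount E B \<le> ecount E ?S + (ecount E ?T + (\<Sum>u\<in>?T. nbrs E u S))" by simp
    also have "\<dots> < card ?S + card ?T"
    proof (rule add_less_le_mono)
      show "ecount E ?S < card ?S" using False assms(5) unfolding acyc_def by blast
      show "ecount E ?T + (\<Sum>u\<in>?T. nbrs E u S) \<le> card ?T" by (rule join) blast
    qed
    also have "\<dots> = card B" using card_Un_disjoint[OF f disj] un by simp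
    finally show ?thesis .
  qed
qed

lemma acyc_singleton:
  assumes "\<forall>e\<in>E. card e = 2"
  shows "acyc E {v}"
proof -
  have "ecount E {v} = 0"
    using ecount_insert[OF assms, of "{}" v] ecount_empty[OF assms] by simp
  then show ?thesis by (auto simp: acyc_def subset_singleton_iff)
qed

lemma acyc_insert:
  assumes E: "\<forall>e\<in>E. card e = 2" and "finite S" "acyc E S" "nbrs E v S \<le> 1"
  shows "acyc E (insert v S)"
proof (cases "v \<in> S")
  case False
  have "acyc E (S \<union> {v})"
  proof (rule acyc_Un[OF E])
    fix B assume "B \<subseteq> {v}"
    then consider "B = {}" | "B = {v}" by auto
    then show "ecount E B + (\<Sum>u\<in>B. nbrs E u S) \<le> card B"
      using assms(4) ecount_empty[OF E] ecount_insert[OF E, of "{}" v] by cases auto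
  qed (use assms False acyc_singleton[OF E] in auto)
  then show ?thesis by simp
qed (use assms in \<open>simp add: insert_absorb\<close>)

section \<open>Changing weights and extending a coloring by one vertex\<close>

lemma col_mono: "col D E k' V M F \<Longrightarrow> (\<And>v. v \<in> V \<Longrightarrow> k v \<le> k' v) \<Longrightarrow> col D E k V M F"
  unfolding col_def by (metis UnI1 add_le_mono le_refl order_trans)

lemma col_insert_F:
  assumes "\<forall>e\<in>E. card e = 2" "finite V" "v \<notin> V" "col D E k V M F" "nbrs E v F \<le> 1"
  shows "col D E k (insert v V) M (insert v F)"
  using assms acyc_insert[of E F v] unfolding col_def by auto

lemma col_insert_M:
  assumes E: "\<forall>e\<in>E. card e = 2" and "finite V" "v \<notin> V" "col D E k V M F"
    and "nbrs E v M \<le> 1" "nbrs E v M + k v \<le> D"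
    and slack: "\<And>u. u \<in> M \<Longrightarrow> {u, v} \<in> E \<Longrightarrow> nbrs E u M + k u + 1 \<le> D"
  shows "col D E k (insert v V) (insert v M) F"
proof -
  have M: "finite M" "v \<notin> M" using assms(2-4) unfolding col_def by auto
  have "nbrs E u (insert v M) + k u \<le> D" if "u \<in> insert v M" for u
  proof (cases "u = v")
    case True
    then show ?thesis using nbrs_self[OF E M(1), of v] assms(6) by simp
  next
    case False
    then have "u \<in> M" using that by simp
    then show ?thesis
      using nbrs_insert[OF M, of E u] slack[of u] assms(4) unfolding col_def by auto
  qed
  then show ?thesis
    using assms(3,4) acyc_insert[OF E M(1) _ assms(5)] unfolding col_def by auto
qed

section \<open>Minimal counterexamples: low degrees and gluing\<close>

definition good :: "nat \<Rightarrow> 'a set set \<Rightarrow> ('a \<Rightarrow> nat) \<Rightarrow> 'a set \<Rightarrow> bool" where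
  "good D E k V \<longleftrightarrow> finite V \<and> (\<forall>e\<in>E. card e = 2) \<and> (\<forall>v\<in>V. k v \<le> D + 1) \<and>
     (\<forall>X\<subseteq>V. pot D E k X \<ge> -2)"

lemma good_subset: "good D E k V \<Longrightarrow> W \<subseteq> V \<Longrightarrow> good D E k W"
  unfolding good_def by (meson finite_subset subset_eq order_trans)

text \<open>Minimality is in the number of vertices alone: gluing adds edges and changes weights, so
  \<open>smaller\<close> has to range over all edge sets and weights on the same vertex
  type.\<close>

locale minimal_counterexample =
  fixes D :: nat and E :: "'a set set" and k :: "'a \<Rightarrow> nat" and V :: "'a set"
  assumes good: "good D E k V"
    and not_col: "\<And>M F. \<not> col D E k V M F"
    and smaller: "\<And>(E' :: 'a set set) k' V'. card V' < card V \<Longrightarrow>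
      good D E' k' V' \<Longrightarrow> \<exists>M F. col D E' k' V' M F"
begin

lemma edge_card: "\<forall>e\<in>E. card e = 2" and fin: "finite V" and k_le: "v \<in> V \<Longrightarrow> k v \<le> D + 1"
  and pot_ge: "X \<subseteq> V \<Longrightarrow> pot D E k X \<ge> -2"
  using good by (auto simp: good_def)

text \<open>For any coloring of \<open>V - {v}\<close>, \<open>v\<close> has at least two neighbours
  in \<open>F\<close>, since otherwise it could join \<open>F\<close>. With degree two, none is left
  in \<open>M\<close>, and only an exhausted capacity keeps \<open>v\<close> out of
  \<open>M\<close>.\<close>

lemma degree_lower:
  assumes v: "v \<in> V"
  shows "2 \<le> nbrs E v V" and "nbrs E v V = 2 \<Longrightarrow> k v = D + 1"
proof -
  let ?W = "V - {v}"
  have W: "finite ?W" "v \<notin> ?W" "insert v ?W = V" using fin v by auto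
  have "card ?W < card V" using fin v by (intro psubset_card_mono) auto
  then obtain M F where c: "col D E k ?W M F"
    using smaller good_subset[OF good, of ?W] by blast
  then have MF: "M \<union> F = ?W" "M \<inter> F = {}" by (auto simp: col_def)
  have fMF: "finite M" "finite F" using MF W(1) by (metis finite_Un)+
  have d: "nbrs E v V = nbrs E v M + nbrs E v F"
    using nbrs_self[OF edge_card W(1), of v] nbrs_Un[OF fMF MF(2), of E v] MF(1) W(3) by simp
  have F2: "nbrs E v F \<ge> 2"
    using col_insert_F[OF edge_card W(1,2) c] not_col W(3) by fastforce
  then show "2 \<le> nbrs E v V" using d by simp
  assume "nbrs E v V = 2"
  then have M0: "nbrs E v M = 0" using F2 d by simp
  then have "{u, v} \<notin> E" if "u \<in> M" for u
    using nbrs_eq_0_iff[OF fMF(1), of E v] that by (simp add: insert_commute)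
  then have "\<not> k v \<le> D"
    using col_insert_M[OF edge_card W(1,2) c] not_col M0 W(3) by auto
  then show "k v = D + 1" using k_le[OF v] by simp
qed

text \<open>Given a coloring of \<open>A\<close>, the set \<open>A\<close> is contracted to one of its vertices \<open>a\<close>, forced into \<open>F\<close>;
  an outside vertex with a neighbour in \<open>FA\<close> becomes adjacent to \<open>a\<close>, and one with a neighbour in
  \<open>MA\<close> is forced into \<open>F\<close>. Either change costs at most as much potential as the edge it replaces.\<close>

lemma glue_F:
  assumes A: "A \<subset> V" and cA: "card A \<ge> 2"
    and one: "\<And>u. u \<in> V - A \<Longrightarrow> nbrs E u A \<le> 1"
    and colA: "col D E k A MA FA"
    and low: "pot D E k A \<le> 3 * int D"
    and min: "\<And>X. X \<subset> V - A \<Longrightarrow> pot D E k A \<le> pot D E k (A \<union> X) + 2"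
    and top: "pot D E k A \<le> 0 \<or> (\<exists>u\<in>V - A. nbrs E u FA \<noteq> 0) \<or> (\<forall>u\<in>V - A. nbrs E u A = 0)"
  shows False
proof -
  define W where "W = V - A"
  obtain a where a: "a \<in> A" using cA by fastforce
  have aW: "a \<notin> W" using a by (simp add: W_def)
  have fA: "finite A" and fW: "finite W" using A fin by (auto simp: W_def intro: finite_subset)
  have MFA: "MA \<union> FA = A" "MA \<inter> FA = {}" using colA by (auto simp: col_def)
  have fMF: "finite MA" "finite FA" using MFA fA by (metis finite_Un)+
  have dA: "nbrs E u A = nbrs E u MA + nbrs E u FA" for u
    using nbrs_Un[OF fMF MFA(2)] MFA(1) by simp
  define E' where "E' = {e \<in> E. e \<subseteq> W} \<union> (\<lambda>u. {u, a}) ` {u \<in> W. nbrs E u FA \<noteq> 0}"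
  define k' where "k' v = (if v = a \<or> nbrs E v MA \<noteq> 0 then D + 1 else k v)" for v
  have E': "\<forall>e\<in>E'. card e = 2" using edge_card aW by (auto simp: E'_def card_2_iff)
  have eW: "ecount E' X = ecount E X" if "X \<subseteq> W" for X
  proof -
    have "{e \<in> E'. e \<subseteq> X} = {e \<in> E. e \<subseteq> X}" using that aW by (auto simp: E'_def)
    then show ?thesis by (simp add: ecount_def)
  qed
  have nW: "nbrs E' u X = nbrs E u X" if "X \<subseteq> W" "u \<in> W" for X u
  proof -
    have "{v \<in> X. {u, v} \<in> E'} = {v \<in> X. {u, v} \<in> E}"
      using that aW by (auto simp: E'_def doubleton_eq_iff)
    then show ?thesis by (simp add: nbrs_def)
  qed
  have na: "nbrs E' a X = (\<Sum>u\<in>X. nbrs E u FA)" if "X \<subseteq> W" for X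
  proof -
    have X: "finite X" using that fW by (rule finite_subset)
    have "{v \<in> X. {a, v} \<in> E'} = {u \<in> X. nbrs E u FA \<noteq> 0}"
      using that aW by (auto simp: E'_def doubleton_eq_iff)
    then have "nbrs E' a X = (\<Sum>u\<in>X. if nbrs E u FA \<noteq> 0 then 1 else 0)"
      using X by (simp add: nbrs_def sum.If_cases Int_def)
    also have "\<dots> = (\<Sum>u\<in>X. nbrs E u FA)"
    proof (rule sum.cong)
      fix u assume "u \<in> X"
      then have "nbrs E u FA \<le> 1" using one[of u] dA[of u] that by (auto simp: W_def)
      then show "(if nbrs E u FA \<noteq> 0 then 1 else 0) = nbrs E u FA" by auto
    qed simp
    finally show ?thesis .
  qed
  have ea: "ecount E' (insert a X) = ecount E X + (\<Sum>u\<in>X. nbrs E u FA)" if "X \<subseteq> W" for X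
    using ecount_insert[OF E', of X a] eW[OF that] na[OF that] that aW fW
    by (auto intro: finite_subset)
  \<comment> \<open>The price of the edges between \<open>X\<close> and \<open>FA\<close>. In the
    new graph these edges end in \<open>a\<close>, so a set without \<open>a\<close> is relieved of
    it.\<close>
  define P where "P X = 3 * (int D + 1) * int (\<Sum>u\<in>X. nbrs E u FA)" for X
  have pot': "pot D E' k' X \<ge> pot D E k (A \<union> X) - pot D E k A + P X" if X: "X \<subseteq> W" for X
  proof -
    have fX: "finite X" using X fW by (rule finite_subset)
    have "(\<Sum>v\<in>X. 6 * int D + 5 - 3 * int (k v) - 3 * (int D + 1) * int (nbrs E v MA))
        \<le> (\<Sum>v\<in>X. 6 * int D + 5 - 3 * int (k' v))"
    proof (rule sum_mono)
      fix u assume "u \<in> X"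
      then have u: "u \<noteq> a" "nbrs E u MA \<le> 1"
        using X aW one[of u] dA[of u] by (auto simp: W_def)
      show "6 * int D + 5 - 3 * int (k u) - 3 * (int D + 1) * int (nbrs E u MA)
          \<le> 6 * int D + 5 - 3 * int (k' u)"
      proof (cases "nbrs E u MA = 0")
        case False
        then have "nbrs E u MA = 1" using u by simp
        then show ?thesis by (simp add: k'_def)
      qed (use u in \<open>simp add: k'_def\<close>)
    qed
    then have "pot D E' k' X \<ge> pot D E k X - 3 * (int D + 1) * int (\<Sum>u\<in>X. nbrs E u MA)"
      unfolding pot_def eW[OF X] by (simp add: sum_subtractf sum_distrib_left)
    moreover have "pot D E k (A \<union> X) = pot D E k A + pot D E k X
        - 3 * (int D + 1) * (int (\<Sum>u\<in>X. nbrs E u MA) + int (\<Sum>u\<in>X. nbrs E u FA))"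
    proof -
      have "A \<inter> X = {}" using X by (auto simp: W_def)
      then show ?thesis using pot_Un[OF edge_card fA fX, of D k] by (simp add: dA sum.distrib)
    qed
    ultimately show ?thesis by (simp add: P_def algebra_simps)
  qed
  have AV: "A \<union> X \<subseteq> V" if "X \<subseteq> W" for X using that A by (auto simp: W_def)
  have "pot D E' k' X \<ge> -2" if X: "X \<subseteq> insert a W" for X
  proof (cases "a \<in> X")
    case True
    define Y where "Y = X - {a}"
    have Y: "Y \<subseteq> W" "insert a Y = X" "a \<notin> Y" "finite Y"
      using X True fW by (auto simp: Y_def intro: finite_subset)
    \<comment> \<open>The vertex \<open>a\<close> contributes 6D+5-3(D+1) = 3D+2, which outweighs
      \<open>low\<close>; its edges use up the surplus \<open>P Y\<close> of
      \<open>pot'\<close>.\<close>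
    have "pot D E' k' X = pot D E' k' Y + 3 * int D + 2 - P Y"
      using pot_insert[OF E' Y(4,3), of D k'] na[OF Y(1)] by (simp add: Y(2) k'_def P_def)
    then show ?thesis using pot'[OF Y(1)] pot_ge[OF AV[OF Y(1)]] low by linarith
  next
    case False
    then have XW: "X \<subseteq> W" using X by auto
    have nn: "P X \<ge> 0"
      unfolding P_def by (intro mult_nonneg_nonneg of_nat_0_le_iff) auto
    consider "X \<subset> W" | "X = W" using XW by blast
    then show ?thesis
    proof cases
      case 1
      then show ?thesis using pot'[OF XW] min[of X] nn by (auto simp: W_def)
    next
      case 2
      \<comment> \<open>Now \<open>A \<union> X\<close> is all of \<open>V\<close>, where
        \<open>min\<close> says nothing. Each alternative of \<open>top\<close> makes up for the
        potential of \<open>A\<close>: it is not positive, or an edge to \<open>FA\<close> yields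
        3D+3, or it splits off from the potential of \<open>V\<close>.\<close>
      from top consider "pot D E k A \<le> 0" | u where "u \<in> W" "nbrs E u FA \<noteq> 0"
        | "\<forall>u\<in>W. nbrs E u A = 0" by (auto simp: W_def)
      then show ?thesis
      proof cases
        case 1
        then show ?thesis using pot'[OF XW] pot_ge[OF AV[OF XW]] nn by linarith
      next
        case (2 u)
        have "(\<Sum>u\<in>X. nbrs E u FA) \<ge> 1"
          using member_le_sum[of u W "\<lambda>u. nbrs E u FA"] 2 \<open>X = W\<close> fW by simp
        then have "int (\<Sum>u\<in>X. nbrs E u FA) \<ge> 1" by linarith
        then have "P X \<ge> 3 * (int D + 1) * 1"
          unfolding P_def by (rule mult_left_mono) simp
        then have "P X \<ge> 3 * int D + 3" by simp
        then show ?thesis using pot'[OF XW] pot_ge[OF AV[OF XW]] low by linarith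
      next
        case 3
        have "pot D E k (A \<union> X) = pot D E k A + pot D E k X"
          using pot_Un[OF edge_card fA fW, of D k] 3 \<open>X = W\<close> by (simp add: W_def)
        moreover have "X \<subseteq> V" using XW by (auto simp: W_def)
        ultimately show ?thesis using pot'[OF XW] pot_ge[of X] nn by simp
      qed
    qed
  qed
  then have "good D E' k' (insert a W)"
    using fW E' k_le by (auto simp: good_def k'_def W_def)
  moreover have "card (insert a W) < card V"
  proof -
    have "card V = card A + card W"
      using A fin fA by (simp add: W_def card_Diff_subset card_mono less_imp_le)
    then show ?thesis using cA aW fW by simp
  qed
  ultimately obtain M F where c: "col D E' k' (insert a W) M F" using smaller by blast
  then have MF: "M \<union> F = insert a W" "M \<inter> F = {}" "acyc E' M" "acyc E' F"
    and dM: "\<And>v. v \<in> M \<Longrightarrow> nbrs E' v M + k' v \<le> D" by (auto simp: col_def)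
  have aM: "a \<notin> M" using dM[of a] by (auto simp: k'_def)
  then have aF: "a \<in> F" and MW: "M \<subseteq> W" using MF by auto
  define F' where "F' = F - {a}"
  have FW: "F' \<subseteq> W" and aF': "a \<notin> F'" "insert a F' = F" using MF aF by (auto simp: F'_def)
  have fM: "finite M" "finite F'" using MW FW fW by (auto intro: finite_subset)
  have M0: "nbrs E u MA = 0" and kk': "k u \<le> k' u" if "u \<in> M" for u
    using dM[OF that] aM that by (auto simp: k'_def split: if_splits)
  have "col D E k V (MA \<union> M) (FA \<union> F')"
    unfolding col_def
  proof (intro conjI ballI)
    show "MA \<union> M \<union> (FA \<union> F') = V"
      using MFA MF aW aM A by (auto simp: F'_def W_def)
    show "(MA \<union> M) \<inter> (FA \<union> F') = {}"
      using MFA MF MW FW by (auto simp: F'_def W_def)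
    show "acyc E (MA \<union> M)"
    proof (rule acyc_Un[OF edge_card fMF(1) fM(1)])
      show "MA \<inter> M = {}" using MFA MW by (auto simp: W_def)
      show "acyc E MA" using colA by (simp add: col_def)
      show am: "acyc E M" using MF(3) eW MW unfolding acyc_def by (metis order_trans)
      show "ecount E B + (\<Sum>u\<in>B. nbrs E u MA) \<le> card B" if "B \<subseteq> M" for B
      proof -
        have "(\<Sum>u\<in>B. nbrs E u MA) = 0" using M0 that by (intro sum.neutral) auto
        then show ?thesis using am that ecount_empty[OF edge_card] unfolding acyc_def
          by (cases "B = {}") (auto simp: less_imp_le)
      qed
    qed
    show "acyc E (FA \<union> F')"
    proof (rule acyc_Un[OF edge_card fMF(2) fM(2)])
      show "FA \<inter> F' = {}" using MFA FW by (auto simp: W_def)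
      show "acyc E FA" using colA by (simp add: col_def)
      have "acyc E' F'" using MF(4) by (rule acyc_mono) (auto simp: F'_def)
      then show "acyc E F'" using eW FW unfolding acyc_def by (metis order_trans)
      show "ecount E B + (\<Sum>u\<in>B. nbrs E u FA) \<le> card B" if B: "B \<subseteq> F'" for B
      proof -
        \<comment> \<open>Since \<open>a\<close> plays the role of the contracted \<open>FA\<close>,
          acyclicity of \<open>F\<close> in \<open>E'\<close> is the join condition for
          \<open>FA\<close>.\<close>
        have "ecount E' (insert a B) < card (insert a B)"
          using MF(4) B aF'(2) unfolding acyc_def by (metis insert_mono insert_not_empty)
        moreover have "card (insert a B) = card B + 1"
          using B aF' fM by (metis Suc_eq_plus1 card_insert_disjoint finite_subset subsetD)
        ultimately show ?thesis using ea[of B] B FW by auto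
      qed
    qed
    fix v assume v: "v \<in> MA \<union> M"
    have disj: "MA \<inter> M = {}" using MFA MW by (auto simp: W_def)
    have n: "nbrs E v (MA \<union> M) = nbrs E v MA + nbrs E v M"
      by (rule nbrs_Un[OF fMF(1) fM(1) disj])
    show "nbrs E v (MA \<union> M) + k v \<le> D"
    proof (cases "v \<in> M")
      case True
      then show ?thesis using n M0[OF True] dM[OF True] kk'[OF True] nW[of M v] MW by auto
    next
      case False
      then have "v \<in> MA" using v by simp
      moreover have "{v, u} \<notin> E" if "u \<in> M" for u
        using M0[OF that] \<open>v \<in> MA\<close> nbrs_eq_0_iff[OF fMF(1), of E u] by (auto simp: insert_commute)
      ultimately show ?thesis
        using n colA nbrs_eq_0_iff[OF fM(1), of E v] by (simp add: col_def)
    qed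
  qed
  then show False using not_col by blast
qed

text \<open>If all edges leaving \<open>A\<close> end in \<open>MA\<close>, contraction gains nothing. Instead one of these edges,
  \<open>{u0, v0}\<close>, may have both ends in \<open>M\<close>, at the price of one unit of capacity at each end, and
  all other outside neighbours of \<open>A\<close> are forced into \<open>F\<close>.\<close>

lemma glue_M:
  assumes A: "A \<subset> V" and cA: "card A \<ge> 2"
    and one: "\<And>u. u \<in> V - A \<Longrightarrow> nbrs E u A \<le> 1"
    and cross: "v0 \<in> A" "u0 \<in> V - A" "{u0, v0} \<in> E"
    and colA: "col D E (k(v0 := min (k v0 + 1) (D + 1))) A MA FA"
    and no_F: "\<And>u. u \<in> V - A \<Longrightarrow> nbrs E u FA = 0"
    and low: "pot D E k A \<le> 3 * int D"
    and min: "\<And>X. X \<subset> V - A \<Longrightarrow> pot D E k A \<le> pot D E k (A \<union> X) + 2"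
  shows False
proof -
  define W where "W = V - A"
  have fA: "finite A" and fW: "finite W" using A fin by (auto simp: W_def intro: finite_subset)
  have MFA: "MA \<union> FA = A" "MA \<inter> FA = {}" using colA by (auto simp: col_def)
  have fMF: "finite MA" "finite FA" using MFA fA by (metis finite_Un)+
  have dA: "nbrs E u A = nbrs E u MA" if "u \<in> W" for u
    using nbrs_Un[OF fMF MFA(2), of E u] MFA(1) no_F that by (simp add: W_def)
  \<comment> \<open>Being in \<open>MA\<close>, \<open>v0\<close> has weight at most
    \<open>D\<close> in the given coloring, so the \<open>min\<close> there is
    \<open>k v0 + 1\<close> and a place is really kept free for \<open>u0\<close>.\<close>
  have v0: "v0 \<in> MA"
    using no_F[OF cross(2)] cross MFA(1) nbrs_eq_0_iff[OF fMF(2), of E u0] by auto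
  have u0: "u0 \<in> W" "nbrs E u0 A = 1"
    using cross one[OF cross(2)] nbrs_eq_0_iff[OF fA, of E u0] by (auto simp: W_def le_Suc_eq)
  define k' where
    "k' v = (if v = u0 then min (k u0 + 1) (D + 1) else if nbrs E v A \<noteq> 0 then D + 1 else k v)" for v
  \<comment> \<open>Trading the edge at \<open>u0\<close>, of price 3(D+1), for one unit of weight,
    of price at most 3, leaves a surplus of 3D: just what \<open>low\<close> requires when
    \<open>X = W\<close>.\<close>
  have pot': "pot D E k' X \<ge> pot D E k (A \<union> X) - pot D E k A + (if u0 \<in> X then 3 * int D else 0)"
    if X: "X \<subseteq> W" for X
  proof -
    have fX: "finite X" using X fW by (rule finite_subset)
    have "(\<Sum>v\<in>X. 6 * int D + 5 - 3 * int (k v) - 3 * (int D + 1) * int (nbrs E v A)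
          + (if v = u0 then 3 * int D else 0))
        \<le> (\<Sum>v\<in>X. 6 * int D + 5 - 3 * int (k' v))"
    proof (rule sum_mono)
      fix u assume "u \<in> X"
      then have u: "nbrs E u A \<le> 1" using X one[of u] by (auto simp: W_def)
      show "6 * int D + 5 - 3 * int (k u) - 3 * (int D + 1) * int (nbrs E u A)
          + (if u = u0 then 3 * int D else 0) \<le> 6 * int D + 5 - 3 * int (k' u)"
      proof (cases "nbrs E u A = 0")
        case False
        then have "nbrs E u A = 1" using u by simp
        then show ?thesis by (simp add: k'_def)
      qed (use u0 in \<open>auto simp: k'_def\<close>)
    qed
    then have "pot D E k' X \<ge> pot D E k X - 3 * (int D + 1) * int (\<Sum>u\<in>X. nbrs E u A)
        + (if u0 \<in> X then 3 * int D else 0)"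
      unfolding pot_def using fX by (simp add: sum_subtractf sum.distrib sum_distrib_left)
    moreover have "pot D E k (A \<union> X) = pot D E k A + pot D E k X
        - 3 * (int D + 1) * int (\<Sum>u\<in>X. nbrs E u A)"
      using X by (intro pot_Un[OF edge_card fA fX]) (auto simp: W_def)
    ultimately show ?thesis by linarith
  qed
  have "pot D E k' X \<ge> -2" if X: "X \<subseteq> W" for X
  proof (cases "X = W")
    case True
    have "pot D E k (A \<union> X) \<ge> -2" using X A by (intro pot_ge) (auto simp: W_def)
    then show ?thesis using pot'[OF X] u0(1) True low by simp
  next
    case False
    then have "pot D E k A \<le> pot D E k (A \<union> X) + 2" using X by (intro min) (auto simp: W_def)
    then show ?thesis using pot'[OF X] by (auto split: if_splits)
  qed
  then have "good D E k' W"
    using fW edge_card k_le by (auto simp: good_def k'_def W_def)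
  moreover have "card W < card V"
    using A cross(1) fin by (intro psubset_card_mono) (auto simp: W_def)
  ultimately obtain M F where c: "col D E k' W M F" using smaller by blast
  then have MF: "M \<union> F = W" "M \<inter> F = {}" "acyc E M" "acyc E F"
    and dM: "\<And>v. v \<in> M \<Longrightarrow> nbrs E v M + k' v \<le> D" by (auto simp: col_def)
  have fM: "finite M" "finite F" using MF(1) fW by (metis finite_Un)+
  have MW: "M \<subseteq> W" and FW: "F \<subseteq> W" using MF by auto
  have M0: "nbrs E u MA = 0" "k u \<le> k' u" if "u \<in> M" "u \<noteq> u0" for u
    using dM[OF that(1)] that dA[of u] MW by (auto simp: k'_def split: if_splits)
  have Mu0: "nbrs E u0 MA = 1" "u0 \<in> M \<Longrightarrow> k' u0 = k u0 + 1"
    using u0 dA dM[of u0] by (auto simp: k'_def)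
  have disj: "MA \<inter> M = {}" using MFA MW by (auto simp: W_def)
  have "col D E k V (MA \<union> M) (FA \<union> F)"
    unfolding col_def
  proof (intro conjI ballI)
    show "MA \<union> M \<union> (FA \<union> F) = V"
      using MFA MF A by (auto simp: W_def)
    show "(MA \<union> M) \<inter> (FA \<union> F) = {}"
      using MFA MF by (auto simp: W_def)
    show "acyc E (MA \<union> M)"
    proof (rule acyc_Un[OF edge_card fMF(1) fM(1) disj _ MF(3)])
      show "acyc E MA" using colA by (simp add: col_def)
      show "ecount E B + (\<Sum>u\<in>B. nbrs E u MA) \<le> card B" if B: "B \<subseteq> M" for B
      proof (cases "B = {}")
        case False
        \<comment> \<open>The only edge that can join \<open>M\<close> to \<open>MA\<close> is
          \<open>{u0, v0}\<close>, and one edge between two forests closes no cycle.\<close>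
        have "(\<Sum>u\<in>B. nbrs E u MA) = (\<Sum>u\<in>B. if u = u0 then 1 else 0)"
          using M0 Mu0 B by (intro sum.cong) auto
        also have "\<dots> \<le> 1" using finite_subset[OF B fM(1)] by (simp add: sum.delta)
        finally have "(\<Sum>u\<in>B. nbrs E u MA) \<le> 1" .
        moreover have "ecount E B < card B" using MF(3) B False unfolding acyc_def by blast
        ultimately show ?thesis by linarith
      qed (use ecount_empty[OF edge_card] in simp)
    qed
    show "acyc E (FA \<union> F)"
    proof (rule acyc_Un[OF edge_card fMF(2) fM(2) _ _ MF(4)])
      show "FA \<inter> F = {}" using MFA FW by (auto simp: W_def)
      show "acyc E FA" using colA by (simp add: col_def)
      show "ecount E B + (\<Sum>u\<in>B. nbrs E u FA) \<le> card B" if B: "B \<subseteq> F" for B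
      proof -
        have "(\<Sum>u\<in>B. nbrs E u FA) = 0" using no_F FW B by (intro sum.neutral) (auto simp: W_def)
        then show ?thesis using MF(4) B ecount_empty[OF edge_card] unfolding acyc_def
          by (cases "B = {}") (auto simp: less_imp_le)
      qed
    qed
    fix v assume v: "v \<in> MA \<union> M"
    have n: "nbrs E v (MA \<union> M) = nbrs E v MA + nbrs E v M"
      by (rule nbrs_Un[OF fMF(1) fM(1) disj])
    show "nbrs E v (MA \<union> M) + k v \<le> D"
    proof (cases "v \<in> M")
      case True
      then show ?thesis using n M0[of v] Mu0 dM[OF True] by (cases "v = u0") auto
    next
      case False
      then have vA: "v \<in> MA" using v by simp
      have *: "u = u0 \<and> v = v0" if "u \<in> M" "{v, u} \<in> E" for u
      proof -
        have uv: "v \<in> {w \<in> MA. {u, w} \<in> E}" using that vA by (simp add: insert_commute)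
        then have "nbrs E u MA \<noteq> 0" using fMF(1) by (auto simp: nbrs_eq_0_iff)
        then have u: "u = u0" using M0(1)[OF that(1)] by metis
        moreover have "v0 \<in> {w \<in> MA. {u, w} \<in> E}" using u v0 cross by simp
        moreover have "card {w \<in> MA. {u, w} \<in> E} = 1" using u Mu0 by (simp add: nbrs_def)
        ultimately show ?thesis using uv by (metis card_1_singletonE singletonD)
      qed
      have "nbrs E v MA + (k(v0 := min (k v0 + 1) (D + 1))) v \<le> D"
        using colA vA by (simp add: col_def)
      moreover have "nbrs E v M \<le> (if v = v0 then 1 else 0)"
      proof -
        have "{u \<in> M. {v, u} \<in> E} \<subseteq> (if v = v0 then {u0} else {})" using * by auto
        from card_mono[OF _ this] show ?thesis by (auto simp: nbrs_def split: if_splits)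
      qed
      ultimately show ?thesis using n by (auto split: if_splits)
    qed
  qed
  then show False using not_col by blast
qed

section \<open>The potential gap for proper subsets\<close>

lemma pot_gap:
  assumes "A \<subset> V" "card A \<ge> 2"
  shows "pot D E k A \<ge> 3 * int D + 1"
proof (rule ccontr)
  assume neg: "\<not> ?thesis"
  let ?S = "{B. B \<subset> V \<and> card B \<ge> 2}"
  have "?S \<subseteq> Pow V" by auto
  then have "finite ?S" using fin by (simp add: finite_subset)
  define B where "B = arg_min_on (pot D E k) ?S"
  have "B \<in> ?S" unfolding B_def using \<open>finite ?S\<close> assms by (intro arg_min_if_finite) auto
  then have B: "B \<subset> V" "card B \<ge> 2" by auto
  have least: "pot D E k B \<le> pot D E k X" if "X \<subset> V" "card X \<ge> 2" for X
    unfolding B_def using \<open>finite ?S\<close> that by (intro arg_min_least) auto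
  have low: "pot D E k B \<le> 3 * int D" using neg least[OF assms] by simp
  have fB: "finite B" using B fin by (meson finite_subset psubset_imp_subset)
  \<comment> \<open>Two edges cost 6D+6, more than the 6D+5 that a vertex brings, so adding
    \<open>u\<close> would undercut the least potential unless it yields \<open>V\<close>. In that
    case degree two with \<open>k u = D + 1\<close>, or degree at least three, pushes the potential
    of \<open>V\<close> down to at most -4.\<close>
  have one: "nbrs E u B \<le> 1" if u: "u \<in> V - B" for u
  proof (rule ccontr)
    assume "\<not> nbrs E u B \<le> 1"
    then have d: "nbrs E u B \<ge> 2" by simp
    have p: "pot D E k (insert u B) = pot D E k B + 6 * int D + 5 - 3 * int (k u)
       - 3 * (int D + 1) * int (nbrs E u B)" using u by (intro pot_insert[OF edge_card fB]) auto
    have m: "3 * (int D + 1) * int (nbrs E u B) \<ge> 3 * (int D + 1) * 2"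
      using d by (intro mult_left_mono) auto
    have c: "card (insert u B) \<ge> 2" using B(2) u fB by simp
    have V: "insert u B = V"
    proof (rule ccontr)
      assume "insert u B \<noteq> V"
      then have "insert u B \<subset> V" using u B by auto
      from least[OF this c] show False using p m by (simp add: algebra_simps)
    qed
    have dV: "nbrs E u V = nbrs E u B" using nbrs_self[OF edge_card fB, of u] V by simp
    have pV: "pot D E k V \<ge> -2" by (simp add: pot_ge)
    show False
    proof (cases "nbrs E u B = 2")
      case True
      then have "k u = D + 1" using degree_lower(2)[of u] u dV by simp
      then show False using p pV low True V by (simp add: algebra_simps)
    next
      case False
      then have "3 * (int D + 1) * int (nbrs E u B) \<ge> 3 * (int D + 1) * 3"
        using d by (intro mult_left_mono) auto
      then show False using p pV low V by (simp add: algebra_simps)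
    qed
  qed
  have min: "pot D E k B \<le> pot D E k (B \<union> X) + 2" if "X \<subset> V - B" for X
  proof -
    have "B \<union> X \<subset> V" using that B by auto
    moreover from this have "finite (B \<union> X)" using fin by (meson finite_subset psubset_imp_subset)
    then have "card (B \<union> X) \<ge> 2" using B(2) card_mono[of "B \<union> X" B] by simp
    ultimately show ?thesis using least[of "B \<union> X"] by simp
  qed
  have cB: "card B < card V" using B fin by (simp add: psubset_card_mono)
  have gB: "good D E k B" using good_subset[OF good] B by blast
  show False
  proof (cases "pot D E k B \<le> 0 \<or> (\<forall>u\<in>V - B. nbrs E u B = 0)")
    case True
    obtain MA FA where "col D E k B MA FA" using smaller[OF cB gB] by blast
    then show False using glue_F[OF B one _ low min] True by blast
  next
    case False
    then obtain u0 v0 where cross: "v0 \<in> B" "u0 \<in> V - B" "{u0, v0} \<in> E" and pos: "pot D E k B \<ge> 1"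
      using nbrs_eq_0_iff[OF fB, of E] by fastforce
    \<comment> \<open>A place at \<open>v0\<close> is reserved before \<open>B\<close> is colored,
      so that the coloring serves \<open>glue_F\<close> or \<open>glue_M\<close>, whichever its
      outside neighbours call for. Potential at least 1 affords this, as 1-3 = -2.\<close>
    define k1 where "k1 = k(v0 := min (k v0 + 1) (D + 1))"
    have kk1: "k v \<le> k1 v" if "v \<in> B" for v
      using k_le[of v] that B by (auto simp: k1_def)
    have k1D: "\<forall>v\<in>B. k1 v \<le> D + 1" using k_le B by (auto simp: k1_def)
    have "good D E k1 B"
      unfolding good_def
    proof (intro conjI allI impI fB edge_card k1D)
      fix X assume X: "X \<subseteq> B"
      have fX: "finite X" using X fB by (rule finite_subset)
      show "pot D E k1 X \<ge> -2"
      proof (cases "card X \<le> 1")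
        case True
        then show ?thesis using pot_small[OF edge_card fX] k1D X by blast
      next
        case False
        have "(\<Sum>v\<in>X. 6 * int D + 5 - 3 * int (k v) - (if v = v0 then 3 else 0))
            \<le> (\<Sum>v\<in>X. 6 * int D + 5 - 3 * int (k1 v))"
          by (intro sum_mono) (auto simp: k1_def)
        then have "pot D E k1 X \<ge> pot D E k X - 3"
          unfolding pot_def sum_subtractf[of _ "\<lambda>v. if v = v0 then 3 else 0"]
          using fX by (auto simp: sum.delta split: if_splits)
        moreover have "pot D E k B \<le> pot D E k X" using False X B least[of X] by auto
        ultimately show ?thesis using pos by simp
      qed
    qed
    then obtain MA FA where c: "col D E k1 B MA FA" using smaller[OF cB] by blast
    show False
    proof (cases "\<exists>u\<in>V - B. nbrs E u FA \<noteq> 0")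
      case True
      then show False using glue_F[OF B one col_mono[OF c kk1] low min] by blast
    next
      case False
      then show False using glue_M[OF B one cross c[unfolded k1_def] _ low min] by blast
    qed
  qed
qed

text \<open>For \<open>D \<ge> 2\<close> the gap \<open>3 * D + 1\<close> leaves room to lower the capacity of all three neighbours
  by one, so a vertex of degree three joins \<open>M\<close> unless its own capacity is used up.\<close>

lemma degree_3:
  assumes D: "D \<ge> 2" and v: "v \<in> V" and deg: "nbrs E v V = 3"
  shows "k v \<ge> D"
proof (rule ccontr)
  assume "\<not> ?thesis"
  then have kv: "k v + 1 \<le> D" by simp
  let ?W = "V - {v}"
  have W: "finite ?W" "v \<notin> ?W" "insert v ?W = V" using fin v by auto
  have cW: "card ?W < card V" using fin v by (intro psubset_card_mono) auto
  define k1 where "k1 u = (if {v, u} \<in> E then min (k u + 1) (D + 1) else k u)" for u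
  have kk1: "k u \<le> k1 u" if "u \<in> ?W" for u
    using k_le[of u] that by (auto simp: k1_def)
  have k1D: "\<forall>u\<in>?W. k1 u \<le> D + 1" using k_le by (auto simp: k1_def)
  have "good D E k1 ?W"
    unfolding good_def
  proof (intro conjI allI impI W(1) edge_card k1D)
    fix X assume X: "X \<subseteq> ?W"
    have fX: "finite X" using X W(1) by (rule finite_subset)
    show "pot D E k1 X \<ge> -2"
    proof (cases "card X \<le> 1")
      case True
      then show ?thesis using pot_small[OF edge_card fX] k1D X by blast
    next
      case False
      have "(\<Sum>u\<in>X. 6 * int D + 5 - 3 * int (k u) - 3 * (if {v, u} \<in> E then 1 else 0))
          \<le> (\<Sum>u\<in>X. 6 * int D + 5 - 3 * int (k1 u))"
        by (intro sum_mono) (auto simp: k1_def)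
      moreover have "(\<Sum>u\<in>X. if {v, u} \<in> E then 1 else 0 :: int) = int (nbrs E v X)"
        using fX by (simp add: nbrs_def sum.If_cases Int_def)
      ultimately have "pot D E k1 X \<ge> pot D E k X - 3 * int (nbrs E v X)"
        unfolding pot_def sum_subtractf[of _ "\<lambda>u. 3 * (if {v, u} \<in> E then 1 else 0)"]
          sum_distrib_left[symmetric] by simp
      moreover have "nbrs E v X \<le> 3" using nbrs_mono[OF fin, of X E v] X deg by auto
      moreover have "pot D E k X \<ge> 3 * int D + 1"
        using X v False by (intro pot_gap) auto
      \<comment> \<open>Tight at \<open>D = 2\<close>: 3D+1-9 = -2.\<close>
      ultimately show ?thesis using D by linarith
    qed
  qed
  then obtain M F where c1: "col D E k1 ?W M F" using smaller[OF cW] by blast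
  then have c: "col D E k ?W M F" using kk1 by (rule col_mono)
  have MF: "M \<union> F = ?W" "M \<inter> F = {}" using c by (auto simp: col_def)
  have fMF: "finite M" "finite F" using MF W(1) by (metis finite_Un)+
  have "nbrs E v V = nbrs E v M + nbrs E v F"
    using nbrs_self[OF edge_card W(1), of v] nbrs_Un[OF fMF MF(2), of E v] MF(1) W(3) by simp
  moreover have "nbrs E v F \<ge> 2"
    using col_insert_F[OF edge_card W(1,2) c] not_col W(3) by fastforce
  ultimately have M1: "nbrs E v M \<le> 1" using deg by simp
  have "col D E k (insert v ?W) (insert v M) F"
  proof (rule col_insert_M[OF edge_card W(1,2) c M1])
    show "nbrs E v M + k v \<le> D" using M1 kv by simp
    fix u assume u: "u \<in> M" "{u, v} \<in> E"
    then have "nbrs E u M + k1 u \<le> D" using c1 by (auto simp: col_def)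
    \<comment> \<open>As \<open>u\<close> lies in \<open>M\<close>, \<open>k1 u\<close> is at most
      \<open>D\<close>, so the \<open>min\<close> equals \<open>k u + 1\<close>.\<close>
    then show "nbrs E u M + k u + 1 \<le> D" using u by (auto simp: k1_def insert_commute)
  qed
  then show False using W(3) not_col by simp
qed

section \<open>The final charge count\<close>

lemma D_less_2: "D < 2"
proof (rule ccontr)
  assume "\<not> D < 2"
  then have D: "D \<ge> 2" by simp
  \<comment> \<open>Charges are doubled to avoid halves. Degree two gives 2(3D+2)-6(D+1) = -2,
    degree three at most 2(3D+5)-9(D+1) = 1-3D, and degree four or more at most 2(6D+5)-12(D+1) =
    -2.\<close>
  let ?ch = "\<lambda>v. 2 * (6 * int D + 5 - 3 * int (k v)) - 3 * (int D + 1) * int (nbrs E v V)"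
  have "V \<noteq> {}"
  proof
    assume "V = {}"
    then have "col D E k V {} {}" by (simp add: col_def)
    then show False using not_col by blast
  qed
  then obtain v where v: "v \<in> V" by blast
  \<comment> \<open>Three vertices are needed: two would only bound the potential by -2, which is
    allowed.\<close>
  have "card (V - {v}) \<ge> 2"
  proof -
    have "nbrs E v V = nbrs E v (V - {v})"
      using nbrs_self[OF edge_card, of "V - {v}" v] fin v by (simp add: insert_absorb)
    also have "\<dots> \<le> card (V - {v})" unfolding nbrs_def using fin by (intro card_mono) auto
    finally show ?thesis using degree_lower(1)[OF v] by simp
  qed
  then have n: "card V \<ge> 3" using v fin by simp
  have "?ch v \<le> -2" if v: "v \<in> V" for v
  proof -
    consider "nbrs E v V = 2" | "nbrs E v V = 3" | "nbrs E v V \<ge> 4"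
      using degree_lower(1)[OF v] by linarith
    then show ?thesis
    proof cases
      case 1
      then show ?thesis using degree_lower(2)[OF v] by simp
    next
      case 2
      then show ?thesis using degree_3[OF D v] D by simp
    next
      case 3
      then have "3 * (int D + 1) * int (nbrs E v V) \<ge> 3 * (int D + 1) * 4"
        by (intro mult_left_mono) auto
      then show ?thesis by simp
    qed
  qed
  then have "(\<Sum>v\<in>V. ?ch v) \<le> (\<Sum>v\<in>V. -2)" by (intro sum_mono)
  also have "\<dots> \<le> -6" using n by simp
  also have "(\<Sum>v\<in>V. ?ch v) = 2 * (\<Sum>v\<in>V. 6 * int D + 5 - 3 * int (k v))
      - 3 * (int D + 1) * int (\<Sum>v\<in>V. nbrs E v V)"
    unfolding sum_subtractf[of "\<lambda>v. 2 * (6 * int D + 5 - 3 * int (k v))"]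
    by (simp only: sum_distrib_left of_nat_sum)
  also have "\<dots> = 2 * pot D E k V"
    unfolding handshake[OF edge_card fin] pot_def by simp
  finally show False using pot_ge[of V] by simp
qed

end

section \<open>From weighted colorings back to sparse graphs\<close>

lemma good_imp_col:
  assumes D: "D \<ge> 2"
  shows "good D E k V \<Longrightarrow> \<exists>M F. col D E k V M F"
proof (induction "card V" arbitrary: E k V rule: less_induct)
  case less
  show ?case
  proof (rule ccontr)
    assume "\<not> ?thesis"
    then interpret minimal_counterexample D E k V
      by unfold_locales (use less in auto)
    show False using D_less_2 D by simp
  qed
qed

text \<open>A cycle through n vertices has n distinct edges inside its vertex set, against the
  strict edge count for that set.\<close>

lemma acyc_imp_forest:
  assumes acyc: "acyc E S"
  shows "forest (S, {e \<in> E. e \<subseteq> S})"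
  unfolding forest_def
proof
  assume "\<exists>c. cycle (S, {e \<in> E. e \<subseteq> S}) c"
  then obtain c where "cycle (S, {e \<in> E. e \<subseteq> S}) c" ..
  then have c: "length c \<ge> 3" "distinct c" "set c \<subseteq> S"
    and edge: "\<And>i. i < length c \<Longrightarrow> {c ! i, c ! (Suc i mod length c)} \<in> E"
    unfolding cycle_def by simp_all
  let ?n = "length c"
  define f where "f i = {c ! i, c ! (Suc i mod ?n)}" for i
  have lt: "Suc i mod ?n < ?n" for i
    using c(1) by (intro mod_less_divisor) linarith
  have "inj_on f {..<?n}"
  proof (rule inj_onI)
    fix i j assume "i \<in> {..<?n}" "j \<in> {..<?n}" and eq: "f i = f j"
    then have ij: "i < ?n" "j < ?n" by simp_all
    have next_eq: "Suc l mod ?n = (if Suc l = ?n then 0 else Suc l)" if "l < ?n" for l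
      using that by simp
    show "i = j"
    proof (rule ccontr)
      assume "i \<noteq> j"
      then have "c ! i \<noteq> c ! j" using nth_eq_iff_index_eq[OF c(2) ij] by simp
      then have "c ! i = c ! (Suc j mod ?n)" "c ! (Suc i mod ?n) = c ! j"
        using eq unfolding f_def doubleton_eq_iff by blast+
      then have "i = Suc j mod ?n" "Suc i mod ?n = j"
        using nth_eq_iff_index_eq[OF c(2) ij(1) lt] nth_eq_iff_index_eq[OF c(2) lt ij(2)] by blast+
      \<comment> \<open>Two positions giving the same edge would be successors of each other, which
        length at least three excludes.\<close>
      then show False using c(1) unfolding next_eq[OF ij(1)] next_eq[OF ij(2)]
        by (simp split: if_splits)
    qed
  qed
  then have "?n = card (f ` {..<?n})" by (simp add: card_image)
  also have "\<dots> \<le> ecount E (set c)"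
    unfolding ecount_def
  proof (rule card_mono)
    show "f ` {..<?n} \<subseteq> {e \<in> E. e \<subseteq> set c}"
    proof (rule image_subsetI)
      fix i assume "i \<in> {..<?n}"
      then have i: "i < ?n" by simp
      show "f i \<in> {e \<in> E. e \<subseteq> set c}"
        using edge[OF i] nth_mem[OF i] nth_mem[OF lt, of i] by (simp add: f_def)
    qed
  qed simp
  also have "\<dots> < card (set c)"
  proof -
    have "set c \<noteq> {}" using c(1) by auto
    then show ?thesis using acyc c(3) unfolding acyc_def by blast
  qed
  finally show False using distinct_card[OF c(2)] by simp
qed

lemma degree_eq_nbrs:
  assumes E: "\<forall>e\<in>E. card e = 2" and "finite S" "v \<in> S"
  shows "degree (S, {e \<in> E. e \<subseteq> S}) v = nbrs E v S"
proof -
  have "{e \<in> {e \<in> E. e \<subseteq> S}. v \<in> e} = (\<lambda>u. {v, u}) ` {u \<in> S. {v, u} \<in> E}"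
  proof (intro equalityI subsetI)
    fix e assume e: "e \<in> {e \<in> {e \<in> E. e \<subseteq> S}. v \<in> e}"
    then obtain u where "e = {v, u}" using E by (fastforce simp: card_2_iff)
    then show "e \<in> (\<lambda>u. {v, u}) ` {u \<in> S. {v, u} \<in> E}" using e by auto
  qed (use assms(3) in auto)
  moreover have "inj_on (\<lambda>u. {v, u}) {u \<in> S. {v, u} \<in> E}"
    by (auto simp: inj_on_def doubleton_eq_iff)
  ultimately show ?thesis by (simp add: degree_def nbrs_def card_image)
qed

theorem theorem1p2:
  fixes D :: nat and G :: "'a graph"
  assumes "D \<ge> 2"
    and "simple_graph G"
    and "sparse ((6 * real D + 5) / (3 * (real D + 1))) (2 / (3 * (real D + 1))) G"
  shows "\<exists>M F. DF_coloring D G M F"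
proof -
  let ?V = "verts G" and ?E = "edges G"
  have fin: "finite ?V" and E: "\<forall>e\<in>?E. card e = 2"
    using assms(2) by (auto simp: simple_graph_def)
  have "pot D ?E (\<lambda>_. 0) X \<ge> -2" if X: "X \<subseteq> ?V" for X
  proof (cases "card X \<le> 1")
    case True
    then show ?thesis using pot_small[OF E finite_subset[OF X fin]] by simp
  next
    case False
    then have "real (ecount ?E X) \<le> (6 * real D + 5) / (3 * (real D + 1)) * real (card X)
        + 2 / (3 * (real D + 1))"
      using assms(3) X by (simp add: sparse_def induced_def ecount_def)
    also have "\<dots> = ((6 * real D + 5) * real (card X) + 2) / (3 * (real D + 1))"
      by (simp only: times_divide_eq_left add_divide_distrib[symmetric])
    \<comment> \<open>Cleared of denominators, sparsity is the bound -2 on the potential with zero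
      weights; all terms are integers, so it passes to \<open>int\<close>.\<close>
    finally have "3 * (real D + 1) * real (ecount ?E X) \<le> (6 * real D + 5) * real (card X) + 2"
      by (simp add: pos_le_divide_eq mult.commute)
    then have "real_of_int (3 * (int D + 1) * int (ecount ?E X))
        \<le> real_of_int ((6 * int D + 5) * int (card X) + 2)"
      by simp
    then have "3 * (int D + 1) * int (ecount ?E X) \<le> (6 * int D + 5) * int (card X) + 2"
      by (simp only: of_int_le_iff)
    then show ?thesis by (simp add: pot_def mult.commute)
  qed
  then have "good D ?E (\<lambda>_. 0) ?V" using fin E by (simp add: good_def)
  then obtain M F where c: "col D ?E (\<lambda>_. 0) ?V M F" using good_imp_col[OF assms(1)] by blast
  then have "finite M" using fin by (metis col_def finite_Un)
  then have "DF_coloring D G M F"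
    using c by (simp add: DF_coloring_def col_def induced_def acyc_imp_forest degree_eq_nbrs[OF E])
  then show ?thesis by blast
qed

end
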